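(* Let $K$ be Kishino's virtual knot, i.e. the virtual knot with signed Gauss code $U1^{+}\,O2^{-}\,O1^{+}\,U2^{-}\,O3^{-}\,U4^{+}\,U3^{-}\,O4^{+}$. Then the group $W_2(K)$ is not infinite cyclic.
   Context: A signed Gauss code lists, in cyclic order along the oriented knot, the passages through the classical crossings; $Oj^{\pm}$ (resp. $Uj^{\pm}$) denotes the passage through crossing $j$ along the over-strand (resp. under-strand), and the superscript is the sign of crossing $j$. Such a code determines a virtual knot, i.e. a virtual knot diagram up to generalized (virtual) Reidemeister moves. The edges of a virtual diagram run from one classical crossing to the next (an edge may pass through virtual crossings). Crossing conventions: draw each classical crossing with both strands oriented downward. At a positive crossing the over-strand runs from top right to bottom left; at a negative crossing the over-strand runs from top left to bottom right. The group $W_2(K)$ is defined from an oriented diagram by a presentation with one generator for each edge and two relations for each classical crossing, using the words $u(x,y)=x^{-1}y^{-1}x$ and $v(x,y)=y^2x$: (i) at a positive crossing with top left edge $a$, top right edge $b$, bottom left edge $c$, bottom right edge $d$, the relations are $c=u(a,b)$, $d=v(a,b)$; (ii) at a negative crossing with bottom left edge $a$, bottom right edge $b$, top left edge $c$, top right edge $d$, the relations are $c=u(a,b)$, $d=v(a,b)$. Virtual crossings give no relations. The resulting group depends, up to isomorphism, only on the virtual knot. *)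

theory Defs
  imports "HOL-Algebra.Elementary_Groups"
begin

section \<open>Groups given by generators and relations\<close>

datatype 'a letter = Gen 'a | Inv 'a

type_synonym 'a word = "'a letter list"

definition words :: "'a set \<Rightarrow> 'a word set" where
  "words X = lists (Gen ` X \<union> Inv ` X)"

fun flip :: "'a letter \<Rightarrow> 'a letter" where
  "flip (Gen x) = Inv x"
| "flip (Inv x) = Gen x"

text \<open>A relation \<open>r = s\<close> is represented by the pair \<open>(r, s)\<close>. Two words represent the same element
  of \<open>\<langle>X | R\<rangle>\<close> iff they are related by the congruence generated by free cancellation and by the
  relations in \<open>R\<close>.\<close>

inductive word_equiv :: "'a set \<Rightarrow> ('a word \<times> 'a word) set \<Rightarrow> 'a word \<Rightarrow> 'a word \<Rightarrow> bool"
  for X :: "'a set" and R :: "('a word \<times> 'a word) set" where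
  refl: "w \<in> words X \<Longrightarrow> word_equiv X R w w"
| sym: "word_equiv X R w w' \<Longrightarrow> word_equiv X R w' w"
| trans: "word_equiv X R w w' \<Longrightarrow> word_equiv X R w' w'' \<Longrightarrow> word_equiv X R w w''"
| cancel: "p \<in> words X \<Longrightarrow> q \<in> words X \<Longrightarrow> [l] \<in> words X \<Longrightarrow>
    word_equiv X R (p @ [l, flip l] @ q) (p @ q)"
| relation: "p \<in> words X \<Longrightarrow> q \<in> words X \<Longrightarrow> (r, s) \<in> R \<Longrightarrow> r \<in> words X \<Longrightarrow> s \<in> words X \<Longrightarrow>
    word_equiv X R (p @ r @ q) (p @ s @ q)"

definition word_class :: "'a set \<Rightarrow> ('a word \<times> 'a word) set \<Rightarrow> 'a word \<Rightarrow> 'a word set" where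
  "word_class X R w = {w'. word_equiv X R w w'}"

definition presented_group :: "'a set \<Rightarrow> ('a word \<times> 'a word) set \<Rightarrow> 'a word set monoid" where
  "presented_group X R =
    \<lparr>carrier = word_class X R ` words X,
     monoid.mult = (\<lambda>A B. {w. \<exists>a\<in>A. \<exists>b\<in>B. word_equiv X R (a @ b) w}),
     one = word_class X R []\<rparr>"

lemma words_append [simp]: "p @ q \<in> words X \<longleftrightarrow> p \<in> words X \<and> q \<in> words X"
  by (auto simp: words_def)

lemma words_Nil [simp]: "[] \<in> words X"
  by (simp add: words_def)

lemma words_flip: "[l] \<in> words X \<Longrightarrow> [flip l] \<in> words X"
  by (cases l) (auto simp: words_def)

lemma words_Cons: "l # p \<in> words X \<longleftrightarrow> [l] \<in> words X \<and> p \<in> words X"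
  by (auto simp: words_def)

lemma word_equiv_words: "word_equiv X R w w' \<Longrightarrow> w \<in> words X \<and> w' \<in> words X"
proof (induction rule: word_equiv.induct)
  case (cancel p q l)
  then show ?case using words_flip[of l X] words_Cons[of l "[flip l]" X] words_append[of "[l, flip l]" q X]
    by (simp del: append.simps)
qed auto

lemma word_equiv_context:
  assumes "word_equiv X R w w'" "p \<in> words X" "q \<in> words X"
  shows "word_equiv X R (p @ w @ q) (p @ w' @ q)"
  using assms
proof (induction rule: word_equiv.induct)
  case (cancel p' q' l)
  then show ?case using word_equiv.cancel[of "p @ p'" X "q' @ q" l R] by simp
next
  case (relation p' q' r s)
  then show ?case using word_equiv.relation[of "p @ p'" X "q' @ q" r s R] by simp
qed (auto intro: word_equiv.intros)

lemma word_equiv_append: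
  assumes "word_equiv X R a a'" "word_equiv X R b b'"
  shows "word_equiv X R (a @ b) (a' @ b')"
  using word_equiv_context[OF assms(1), of "[]" b] word_equiv_context[OF assms(2), of a' "[]"]
    word_equiv_words[OF assms(1)] word_equiv_words[OF assms(2)]
  by (auto intro: word_equiv.trans)

lemma word_class_eq_iff:
  assumes "w \<in> words X"
  shows "word_class X R w = word_class X R w' \<longleftrightarrow> word_equiv X R w w'"
proof
  assume "word_class X R w = word_class X R w'"
  then have "word_equiv X R w' w"
    using word_equiv.refl[OF assms, of R] by (auto simp: word_class_def)
  then show "word_equiv X R w w'" by (rule word_equiv.sym)
qed (auto simp: word_class_def intro: word_equiv.sym word_equiv.trans)

lemma mult_word_class:
  assumes "a \<in> words X" "b \<in> words X"
  shows "word_class X R a \<otimes>\<^bsub>presented_group X R\<^esub> word_class X R b = word_class X R (a @ b)"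
  using assms unfolding presented_group_def word_class_def
  by (auto intro: word_equiv.refl word_equiv.trans word_equiv_append)

lemma word_equiv_inverse:
  "w \<in> words X \<Longrightarrow> \<exists>w'\<in>words X. word_equiv X R (w' @ w) []"
proof (induction w)
  case Nil
  then show ?case by (auto intro!: bexI[of _ "[]"] word_equiv.refl)
next
  case (Cons l w)
  then have l: "[flip l] \<in> words X" and w: "w \<in> words X"
    using words_flip words_Cons by blast+
  then obtain w' where w': "w' \<in> words X" "word_equiv X R (w' @ w) []" using Cons.IH by blast
  have "word_equiv X R (w' @ [flip l, flip (flip l)] @ w) (w' @ w)"
    using w'(1) w l by (rule word_equiv.cancel)
  moreover have "flip (flip l) = l" by (cases l) auto
  ultimately have "word_equiv X R ((w' @ [flip l]) @ (l # w)) []"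
    using w'(2) by (auto intro: word_equiv.trans)
  moreover have "w' @ [flip l] \<in> words X" using w'(1) l by simp
  ultimately show ?case by blast
qed

lemma group_presented_group: "group (presented_group X R)"
proof (rule groupI)
  have carrier: "carrier (presented_group X R) = word_class X R ` words X"
    and one: "\<one>\<^bsub>presented_group X R\<^esub> = word_class X R []"
    by (simp_all add: presented_group_def)
  show "\<one>\<^bsub>presented_group X R\<^esub> \<in> carrier (presented_group X R)"
    by (simp add: carrier one)
  fix A assume A: "A \<in> carrier (presented_group X R)"
  then obtain a where a: "a \<in> words X" "A = word_class X R a" by (auto simp: carrier)
  show "\<one>\<^bsub>presented_group X R\<^esub> \<otimes>\<^bsub>presented_group X R\<^esub> A = A"
    using a by (simp add: one mult_word_class)
  obtain a' where "a' \<in> words X" "word_equiv X R (a' @ a) []"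
    using word_equiv_inverse[OF a(1)] by blast
  then have "word_class X R a' \<in> carrier (presented_group X R)"
    and "word_class X R a' \<otimes>\<^bsub>presented_group X R\<^esub> A = \<one>\<^bsub>presented_group X R\<^esub>"
    using a by (auto simp: carrier one mult_word_class word_class_eq_iff)
  then show "\<exists>B\<in>carrier (presented_group X R).
      B \<otimes>\<^bsub>presented_group X R\<^esub> A = \<one>\<^bsub>presented_group X R\<^esub>" by blast
  fix B assume "B \<in> carrier (presented_group X R)"
  then obtain b where b: "b \<in> words X" "B = word_class X R b" by (auto simp: carrier)
  show "A \<otimes>\<^bsub>presented_group X R\<^esub> B \<in> carrier (presented_group X R)"
    using a b by (simp add: carrier mult_word_class)
  fix C assume "C \<in> carrier (presented_group X R)"
  then obtain c where "c \<in> words X" "C = word_class X R c" by (auto simp: carrier)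
  then show "A \<otimes>\<^bsub>presented_group X R\<^esub> B \<otimes>\<^bsub>presented_group X R\<^esub> C =
      A \<otimes>\<^bsub>presented_group X R\<^esub> (B \<otimes>\<^bsub>presented_group X R\<^esub> C)"
    using a b by (simp add: mult_word_class)
qed


section \<open>Signed Gauss codes\<close>

datatype sign = Positive | Negative

text \<open>\<open>Over j s\<close> and \<open>Under j s\<close> are the passages through crossing \<open>j\<close>, of sign \<open>s\<close>, along the
  over-strand and the under-strand.\<close>

datatype passage = Over nat sign | Under nat sign

fun crossing_of :: "passage \<Rightarrow> nat \<times> sign" where
  "crossing_of (Over j s) = (j, s)"
| "crossing_of (Under j s) = (j, s)"

text \<open>Every crossing is passed exactly once over and once under, with the same sign. The list is
  read cyclically.\<close>

definition signed_gauss_code :: "passage list \<Rightarrow> bool" where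
  "signed_gauss_code D \<longleftrightarrow> distinct D
    \<and> (\<forall>j s. Over j s \<in> set D \<longleftrightarrow> Under j s \<in> set D)
    \<and> inj_on fst (crossing_of ` set D)"

text \<open>Edge \<open>i\<close> is the edge arriving at the passage at position \<open>i\<close> of the code; it starts at the
  cyclically preceding passage. The code without crossings describes a closed curve, which counts
  as a single edge.\<close>

definition edges :: "passage list \<Rightarrow> nat set" where
  "edges D = {..<max 1 (length D)}"

definition edge_in :: "passage list \<Rightarrow> nat \<Rightarrow> nat" where
  "edge_in D i = i"

definition edge_out :: "passage list \<Rightarrow> nat \<Rightarrow> nat" where
  "edge_out D i = Suc i mod length D"


section \<open>The group \<open>W\<^sub>2\<close>\<close>

definition u_word :: "'a \<Rightarrow> 'a \<Rightarrow> 'a word" where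
  "u_word x y = [Inv x, Inv y, Gen x]"

definition v_word :: "'a \<Rightarrow> 'a \<Rightarrow> 'a word" where
  "v_word x y = [Gen y, Gen y, Gen x]"

text \<open>The edges around a crossing drawn with both strands oriented downward.\<close>

fun crossing_relations ::
  "sign \<Rightarrow> 'a \<Rightarrow> 'a \<Rightarrow> 'a \<Rightarrow> 'a \<Rightarrow> ('a word \<times> 'a word) set" where
  "crossing_relations Positive top_left top_right bottom_left bottom_right =
    {([Gen bottom_left], u_word top_left top_right),
     ([Gen bottom_right], v_word top_left top_right)}"
| "crossing_relations Negative top_left top_right bottom_left bottom_right =
    {([Gen top_left], u_word bottom_left bottom_right),
     ([Gen top_right], v_word bottom_left bottom_right)}"

text \<open>With both strands oriented downward, the over-strand of a positive crossing runs from top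
  right to bottom left, hence its under-strand from top left to bottom right; at a negative
  crossing it is the other way round.\<close>

fun strand_relations ::
  "sign \<Rightarrow> 'a \<Rightarrow> 'a \<Rightarrow> 'a \<Rightarrow> 'a \<Rightarrow> ('a word \<times> 'a word) set" where
  "strand_relations Positive over_in over_out under_in under_out =
    crossing_relations Positive under_in over_in over_out under_out"
| "strand_relations Negative over_in over_out under_in under_out =
    crossing_relations Negative over_in under_in under_out over_out"

definition W2_relations :: "passage list \<Rightarrow> (nat word \<times> nat word) set" where
  "W2_relations D = \<Union> {strand_relations s (edge_in D i) (edge_out D i) (edge_in D k) (edge_out D k) |
     i k j s. i < length D \<and> k < length D \<and> D ! i = Over j s \<and> D ! k = Under j s}"

definition W2 :: "passage list \<Rightarrow> nat word set monoid" where
  "W2 D = presented_group (edges D) (W2_relations D)"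


section \<open>Kishino's knot\<close>

definition kishino :: "passage list" where
  "kishino = [Under 1 Positive, Over 2 Negative, Over 1 Positive, Under 2 Negative,
              Over 3 Negative, Under 4 Positive, Under 3 Negative, Over 4 Positive]"

lemma signed_gauss_code_kishino: "signed_gauss_code kishino"
  by (auto simp: signed_gauss_code_def kishino_def)

end

theory Submission
  imports Defs "HOL-Library.Numeral_Type"
begin

text \<open>An infinite cyclic group is abelian, so it suffices to find two generators of the group that
  do not commute. They are separated by an action of the group on the residues modulo 5 in which
  every edge acts by an affine map. In the abelianization, which is infinite cyclic, the edges
  0, ..., 7 become -3, -1, 1, -1, -3, 3, 9, 3 times a generator; letting that generator act with
  slope 2 makes the slopes alternate between 2 and 3. The translations were found by a search.\<close>

text \<open>\<open>inverse\<close> handles free cancellation and \<open>relator\<close> the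
  relations, so letting the letters of a word act one after another, the last letter first, is well
  defined on the presented group.\<close>

lemma foldr_word_equiv:
  assumes "word_equiv X R w w'"
    and inverse: "\<And>l x. [l] \<in> words X \<Longrightarrow> act l (act (flip l) x) = x"
    and relator: "\<And>r s x. (r, s) \<in> R \<Longrightarrow> foldr act r x = foldr act s x"
  shows "foldr act w x = foldr act w' x"
  using assms(1) by (induction arbitrary: x) (simp_all add: inverse relator)

lemma presented_group_commute:
  assumes "comm_group (presented_group X R)" and "a \<in> words X" "b \<in> words X"
  shows "word_equiv X R (a @ b) (b @ a)"
proof -
  interpret comm_group "presented_group X R" by fact
  have "word_class X R a \<in> carrier (presented_group X R)"
    and "word_class X R b \<in> carrier (presented_group X R)"
    using assms by (simp_all add: presented_group_def)
  then have "word_class X R (a @ b) = word_class X R (b @ a)"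
    using m_comm assms by (metis mult_word_class)
  then show ?thesis
    using assms by (simp add: word_class_eq_iff)
qed

text \<open>The slopes 2 and 3 are inverse to each other modulo 5, so \<open>Inv i\<close> undoes
  \<open>Gen i\<close>.\<close>

fun kishino_action :: "nat letter \<Rightarrow> 5 \<Rightarrow> 5" where
  "kishino_action (Gen i) n = (if even i then 2 else 3) * n + [0, 1, 2, 2, 4, 2, 2, 1] ! i"
| "kishino_action (Inv i) n = (if even i then 3 else 2) * (n - [0, 1, 2, 2, 4, 2, 2, 1] ! i)"

lemma numerals_mod_5:
  "(5 :: 5) = 0" "(6 :: 5) = 1" "(10 :: 5) = 0" "(15 :: 5) = 0" "(20 :: 5) = 0" "(25 :: 5) = 0"
  by simp_all

lemma kishino_action_flip: "kishino_action l (kishino_action (flip l) n) = n"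
  by (cases l) (simp_all add: mult.assoc [symmetric] numerals_mod_5)

lemma kishino_Over:
  assumes "i < length kishino" "kishino ! i = Over j s"
  shows "(i, j, s) \<in> {(1, 2, Negative), (2, 1, Positive), (4, 3, Negative), (7, 4, Positive)}"
  using assms by (auto simp: kishino_def less_Suc_eq)

lemma kishino_Under:
  assumes "i < length kishino" "kishino ! i = Under j s"
  shows "(i, j, s) \<in> {(0, 1, Positive), (3, 2, Negative), (5, 4, Positive), (6, 3, Negative)}"
  using assms by (auto simp: kishino_def less_Suc_eq)

text \<open>The four blocks come from crossings 1, 2, 3, 4 in this order. In the last one the
  over-strand leaves along edge 0 because the code is cyclic.\<close>

lemma W2_relations_kishino:
  "W2_relations kishino \<subseteq>
    strand_relations Positive 2 3 0 1 \<union> strand_relations Negative 1 2 3 4 \<union>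
    strand_relations Negative 4 5 6 7 \<union> strand_relations Positive 7 0 5 6"
  (is "_ \<subseteq> ?S")
proof -
  have len: "length kishino = 8"
    by (simp add: kishino_def)
  have "strand_relations s i (Suc i mod 8) k (Suc k mod 8) \<subseteq> ?S"
    if "i < length kishino" "k < length kishino" "kishino ! i = Over j s" "kishino ! k = Under j s"
    for i k j s
  proof -
    \<comment> \<open>The common crossing \<open>j\<close> pairs each over-passage with its
      under-passage.\<close>
    have "(i, k, s) \<in> {(2, 0, Positive), (1, 3, Negative), (4, 6, Negative), (7, 5, Positive)}"
      using kishino_Over [OF that(1,3)] kishino_Under [OF that(2,4)] by auto
    then show ?thesis
      by (elim insertE) (auto simp: numeral_2_eq_2 [symmetric])
  qed
  then show ?thesis
    unfolding W2_relations_def edge_in_def edge_out_def len by blast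
qed

lemma kishino_action_relations:
  assumes "(r, s) \<in> W2_relations kishino"
  shows "foldr kishino_action r n = foldr kishino_action s n"
proof -
  have "(r, s) \<in>
      strand_relations Positive 2 3 0 1 \<union> strand_relations Negative 1 2 3 4 \<union>
      strand_relations Negative 4 5 6 7 \<union> strand_relations Positive 7 0 5 6"
    using assms W2_relations_kishino by (rule set_rev_mp)
  then show ?thesis
    \<comment> \<open>Both sides of each relation are affine in \<open>n\<close>, with equal
      coefficients modulo 5.\<close>
    by (auto simp: u_word_def v_word_def algebra_simps numerals_mod_5)
qed

theorem proposition2p2:
  shows "\<not> (cyclic_group (W2 kishino) \<and> infinite (carrier (W2 kishino)))"
proof
  assume "cyclic_group (W2 kishino) \<and> infinite (carrier (W2 kishino))"
  then have "comm_group (W2 kishino)"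
    using group.cyclic_imp_abelian_group group_presented_group unfolding W2_def by blast
  then have "word_equiv (edges kishino) (W2_relations kishino) ([Gen 0] @ [Gen 1]) ([Gen 1] @ [Gen 0])"
    unfolding W2_def
    by (rule presented_group_commute) (simp_all add: words_def edges_def kishino_def)
  then have "foldr kishino_action ([Gen 0] @ [Gen 1]) 0 = foldr kishino_action ([Gen 1] @ [Gen 0]) 0"
    by (rule foldr_word_equiv) (simp_all add: kishino_action_flip kishino_action_relations)
  \<comment> \<open>Edge 0 acts by doubling and edge 1 sends 0 to 1, so the left side is 2 and the
    right side is 1.\<close>
  then show False
    by simp
qed

end
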